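(* For any non-negative integers $m_1,m_2,n_1,n_2$ and any complex numbers $x,y,z$, \[ \frac{H_{m_1+m_2,\,n_1+n_2}(x,y,z)}{m_1!\,m_2!\,n_1!\,n_2!} =\sum_{p_1=0}^{\min\{m_1,n_2\}}\ \sum_{p_2=0}^{\min\{n_1,m_2\}} \frac{H_{m_1-p_1,\,n_1-p_2}(x,y,z)\,H_{m_2-p_2,\,n_2-p_1}(x,y,z)\,z^{p_1+p_2}}{p_1!\,p_2!\,(m_1-p_1)!\,(m_2-p_2)!\,(n_1-p_2)!\,(n_2-p_1)!}. \]
   Context: For complex numbers $x,y,z$ and non-negative integers $m,n$, the (three-variable) complex Hermite polynomials are defined by \[ H_{m,n}(x,y,z)=\sum_{k=0}^{\min\{m,n\}} k!\binom{m}{k}\binom{n}{k}x^{m-k}y^{n-k}z^k . \] *)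

theory Defs
  imports Complex_Main
begin

definition hermite_H :: "nat \<Rightarrow> nat \<Rightarrow> complex \<Rightarrow> complex \<Rightarrow> complex \<Rightarrow> complex" where
  "hermite_H m n x y z =
     (\<Sum>k = 0..min m n. fact k * of_nat (m choose k) * of_nat (n choose k)
        * x ^ (m - k) * y ^ (n - k) * z ^ k)"

end

theory Submission
  imports Defs
begin

text \<open>
  Extend \<open>h(a, n) = H\<^sub>a\<^sub>,\<^sub>n / a!\<close> by zero to negative \<open>a\<close> and let \<open>S\<close> be the shift
  \<open>a \<mapsto> a - 1\<close>; then \<open>h(_, n) = (y + z S)\<^sup>n e\<close> with \<open>e(a) = x\<^sup>a / a!\<close>. Likewise
  \<open>G(a, b) = H\<^bsub>a+b,n\<^esub> / (a! b!)\<close> is obtained by applying \<open>(y + z S\<^sub>1 + z S\<^sub>2)\<^sup>n\<close> to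
  \<open>e(a) e(b)\<close>. The formula results from splitting \<open>n = n\<^sub>1 + n\<^sub>2\<close> and expanding the first
  \<open>n\<^sub>1\<close> factors binomially as \<open>(y + z S\<^sub>1) + z S\<^sub>2\<close> and the other \<open>n\<^sub>2\<close> factors as
  \<open>(y + z S\<^sub>2) + z S\<^sub>1\<close>.
\<close>

text \<open>Pascal's rule, arranged to add one factor to a binomial expansion: if
  \<open>F p q\<close> stands for B^p A^q applied to a fixed sequence, with commuting operators A
  and B, this is (A + B)^(n+1) = (A + B) (A + B)^n.\<close>

lemma sum_binomial_Suc:
  fixes F :: "nat \<Rightarrow> nat \<Rightarrow> 'a::comm_semiring_1"
  shows "(\<Sum>p\<le>Suc n. of_nat (Suc n choose p) * F p (Suc n - p))
    = (\<Sum>p\<le>n. of_nat (n choose p) * (F p (Suc (n - p)) + F (Suc p) (n - p)))"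
proof -
  have "(\<Sum>p\<le>Suc n. of_nat (Suc n choose p) * F p (Suc n - p))
     = F 0 (Suc n) + (\<Sum>p\<le>n. of_nat (n choose Suc p) * F (Suc p) (n - p))
        + (\<Sum>p\<le>n. of_nat (n choose p) * F (Suc p) (n - p))"
    by (subst sum.atMost_Suc_shift) (simp add: sum.distrib algebra_simps)
  also have "F 0 (Suc n) + (\<Sum>p\<le>n. of_nat (n choose Suc p) * F (Suc p) (n - p))
     = (\<Sum>p\<le>Suc n. of_nat (n choose p) * F p (Suc n - p))"
    by (subst sum.atMost_Suc_shift) simp
  also have "\<dots> = (\<Sum>p\<le>n. of_nat (n choose p) * F p (Suc (n - p)))"
    by (simp add: Suc_diff_le binomial_eq_0)
  finally show ?thesis
    by (simp add: sum.distrib algebra_simps)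
qed

definition exp_coeff :: "complex \<Rightarrow> int \<Rightarrow> complex" where
  "exp_coeff x a = (if a < 0 then 0 else x ^ nat a / fact (nat a))"

definition herm :: "complex \<Rightarrow> complex \<Rightarrow> complex \<Rightarrow> int \<Rightarrow> nat \<Rightarrow> complex" where
  "herm x y z a n = (\<Sum>k\<le>n. of_nat (n choose k) * (z ^ k * y ^ (n - k) * exp_coeff x (a - int k)))"

definition binom2 :: "int \<Rightarrow> int \<Rightarrow> complex" where
  "binom2 a b = (if a < 0 \<or> b < 0 then 0 else of_nat (nat (a + b) choose nat a))"

text \<open>This is G of the overview: for a, b nonnegative, the binomial coefficient turns the
  factor 1/(a+b)! inside \<open>herm\<close> into 1/(a! b!).\<close>

definition herm2 :: "complex \<Rightarrow> complex \<Rightarrow> complex \<Rightarrow> int \<Rightarrow> int \<Rightarrow> nat \<Rightarrow> complex" where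
  "herm2 x y z a b n = binom2 a b * herm x y z (a + b) n"

lemma herm_neg: "a < 0 \<Longrightarrow> herm x y z a n = 0"
  by (simp add: herm_def exp_coeff_def)

lemma herm_of_nat: "herm x y z (int m) n = hermite_H m n x y z / fact m"
proof -
  have "herm x y z (int m) n
     = (\<Sum>k\<in>{0..min m n}. of_nat (n choose k) * (z ^ k * y ^ (n - k) * exp_coeff x (int m - int k)))"
    unfolding herm_def by (rule sum.mono_neutral_right) (auto simp: exp_coeff_def)
  also have "\<dots> = hermite_H m n x y z / fact m"
    unfolding hermite_H_def sum_divide_distrib
  proof (rule sum.cong[OF refl])
    fix k assume "k \<in> {0..min m n}"
    then have k: "k \<le> m" by simp
    have c: "(of_nat (m choose k) :: complex) = fact m / (fact k * fact (m - k))"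
      using k by (rule binomial_fact)
    have "nat (int m - int k) = m - k" using k by simp
    then show "of_nat (n choose k) * (z ^ k * y ^ (n - k) * exp_coeff x (int m - int k))
      = fact k * of_nat (m choose k) * of_nat (n choose k) * x ^ (m - k) * y ^ (n - k) * z ^ k / fact m"
      using k by (simp add: exp_coeff_def c field_simps)
  qed
  finally show ?thesis .
qed

lemma herm_Suc: "herm x y z a (Suc n) = y * herm x y z a n + z * herm x y z (a - 1) n"
  unfolding herm_def
    sum_binomial_Suc[where F = "\<lambda>p q. z ^ p * y ^ q * exp_coeff x (a - int p)"]
  by (simp add: sum_distrib_left sum.distrib[symmetric] algebra_simps)

text \<open>The extension by zero breaks Pascal's rule at the origin, where the left side is 1 and
  the right side 0; the hypothesis excludes this point.\<close>

lemma binom2_Pascal: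
  assumes "a + b \<noteq> 0"
  shows "binom2 a b = binom2 (a - 1) b + binom2 a (b - 1)"
proof (cases "0 < a \<and> 0 < b")
  case True
  then obtain i j where "a = int (Suc i)" "b = int (Suc j)"
    by (metis zero_less_imp_eq_int gr0_conv_Suc)
  moreover have "nat (1 + (int i + int j)) = Suc (i + j)"
    "nat (2 + (int i + int j)) = Suc (Suc (i + j))" by auto
  ultimately show ?thesis
    by (simp add: binom2_def nat_add_distrib)
next
  case False
  then consider "a < 0 \<or> b < 0" | "a = 0" "0 < b" | "b = 0" "0 < a"
    using assms by linarith
  then show ?thesis
    by cases (auto simp: binom2_def)
qed

lemma herm2_Suc:
  "herm2 x y z a b (Suc n)
    = y * herm2 x y z a b n + z * (herm2 x y z (a - 1) b n + herm2 x y z a (b - 1) n)"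
proof -
  have "binom2 a b * herm x y z (a + b - 1) n
      = (binom2 (a - 1) b + binom2 a (b - 1)) * herm x y z (a + b - 1) n"
    by (cases "a + b = 0") (simp_all add: herm_neg flip: binom2_Pascal)
  then show ?thesis
    by (simp add: herm2_def herm_Suc algebra_simps)
qed

lemma herm2_0: "herm2 x y z a b 0 = herm x y z a 0 * herm x y z b 0"
proof (cases "a < 0 \<or> b < 0")
  case True
  then show ?thesis
    by (auto simp: herm2_def binom2_def herm_neg)
next
  case False
  then show ?thesis
    by (simp add: herm2_def binom2_def herm_def exp_coeff_def nat_add_distrib
        binomial_fact power_add)
qed

lemma herm2_commute: "herm2 x y z a b n = herm2 x y z b a n"
proof -
  have "binom2 a b = binom2 b a"
    by (simp add: binom2_def add.commute nat_add_distrib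
        binomial_symmetric[of "nat a" "nat a + nat b"])
  then show ?thesis
    by (simp add: herm2_def add.commute)
qed

text \<open>One more factor, split as (y + z S1) + z S2: by \<open>herm_Suc\<close> the first
  summand raises n - p, while the second raises p. The assumption covers all a and b because the
  factor shifts them. The inner sum is left generic so that the step serves both expansions
  below.\<close>

lemma herm2_expand_step:
  assumes "\<And>a b. herm2 x y z a b N
    = (\<Sum>p\<le>n. of_nat (n choose p) * (\<Sum>q\<in>Q. c q * z ^ p * herm x y z (a - int q) (n - p)
         * herm x y z (b - int p) (r q)))"
  shows "herm2 x y z a b (Suc N)
    = (\<Sum>p\<le>Suc n. of_nat (Suc n choose p) * (\<Sum>q\<in>Q. c q * z ^ p
         * herm x y z (a - int q) (Suc n - p) * herm x y z (b - int p) (r q)))"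
proof -
  have shift: "a - 1 - int q = a - int q - 1" "b - int (Suc p) = b - 1 - int p" for q p
    by simp_all
  show ?thesis
    unfolding herm2_Suc assms shift
      sum_binomial_Suc[where F = "\<lambda>p s. \<Sum>q\<in>Q. c q * z ^ p
         * herm x y z (a - int q) s * herm x y z (b - int p) (r q)"]
    by (simp add: herm_Suc sum_distrib_left sum.distrib ring_distribs mult_ac)
qed

lemma herm2_expand1:
  "herm2 x y z a b n
    = (\<Sum>p\<le>n. of_nat (n choose p) * (z ^ p * herm x y z a (n - p) * herm x y z (b - int p) 0))"
proof (induction n arbitrary: a b)
  case 0
  show ?case by (simp add: herm2_0)
next
  case (Suc n)
  show ?case
    using herm2_expand_step[where Q = "{0}" and c = "\<lambda>_. 1" and r = "\<lambda>_. 0" and n = n and N = n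
        and x = x and y = y and z = z and a = a and b = b] Suc.IH
    by simp
qed

lemma herm2_expand:
  "herm2 x y z a b (n + n')
    = (\<Sum>p\<le>n. of_nat (n choose p) * (\<Sum>q\<le>n'. of_nat (n' choose q) * z ^ q * z ^ p
         * herm x y z (a - int q) (n - p) * herm x y z (b - int p) (n' - q)))"
proof (induction n arbitrary: a b)
  case 0
  \<comment> \<open>The n' factors have to be split the other way, as (y + z S2) + z S1; exchanging
    a and b reduces this to \<open>herm2_expand1\<close>.\<close>
  show ?case
    by (subst herm2_commute) (simp add: herm2_expand1 mult_ac)
next
  case (Suc n)
  show ?case
    using herm2_expand_step[OF Suc.IH] by simp
qed

theorem theorem4p2:
  fixes m1 m2 n1 n2 :: nat and x y z :: complex
  shows "hermite_H (m1 + m2) (n1 + n2) x y z / (fact m1 * fact m2 * fact n1 * fact n2)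
    = (\<Sum>p1 = 0..min m1 n2. \<Sum>p2 = 0..min n1 m2.
        hermite_H (m1 - p1) (n1 - p2) x y z * hermite_H (m2 - p2) (n2 - p1) x y z
          * z ^ (p1 + p2)
        / (fact p1 * fact p2 * fact (m1 - p1) * fact (m2 - p2)
           * fact (n1 - p2) * fact (n2 - p1)))"
proof -
  define t where "t q p = of_nat (n1 choose p) * of_nat (n2 choose q) * z ^ (q + p)
     * herm x y z (int m1 - int q) (n1 - p) * herm x y z (int m2 - int p) (n2 - q)
     / (fact n1 * fact n2)" for q p
  have "herm2 x y z (int m1) (int m2) (n1 + n2)
      = hermite_H (m1 + m2) (n1 + n2) x y z / (fact m1 * fact m2)"
    using herm_of_nat[of x y z "m1 + m2" "n1 + n2"]
    by (simp add: herm2_def binom2_def nat_add_distrib binomial_fact)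
  then have "hermite_H (m1 + m2) (n1 + n2) x y z / (fact m1 * fact m2 * fact n1 * fact n2)
      = herm2 x y z (int m1) (int m2) (n1 + n2) / (fact n1 * fact n2)"
    by simp
  also have "\<dots> = (\<Sum>p\<le>n1. \<Sum>q\<le>n2. t q p)"
    by (simp add: herm2_expand t_def sum_distrib_left sum_divide_distrib power_add mult_ac)
  also have "\<dots> = (\<Sum>q\<le>n2. \<Sum>p\<le>n1. t q p)"
    by (rule sum.swap)
  \<comment> \<open>Terms with q > m1, and in the next step p > m2, contain \<open>herm\<close> at a
    negative index and vanish.\<close>
  also have "\<dots> = (\<Sum>q = 0..min m1 n2. \<Sum>p\<le>n1. t q p)"
    by (rule sum.mono_neutral_right) (auto simp: t_def herm_neg)
  also have "\<dots> = (\<Sum>q = 0..min m1 n2. \<Sum>p = 0..min n1 m2. t q p)"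
    by (intro sum.cong[OF refl] sum.mono_neutral_right) (auto simp: t_def herm_neg)
  also have "\<dots> = (\<Sum>q = 0..min m1 n2. \<Sum>p = 0..min n1 m2.
        hermite_H (m1 - q) (n1 - p) x y z * hermite_H (m2 - p) (n2 - q) x y z
          * z ^ (q + p)
        / (fact q * fact p * fact (m1 - q) * fact (m2 - p)
           * fact (n1 - p) * fact (n2 - q)))"
  proof (intro sum.cong[OF refl])
    fix q p assume "q \<in> {0..min m1 n2}" "p \<in> {0..min n1 m2}"
    then have "q \<le> m1" "q \<le> n2" "p \<le> n1" "p \<le> m2" by auto
    then show "t q p = hermite_H (m1 - q) (n1 - p) x y z * hermite_H (m2 - p) (n2 - q) x y z
          * z ^ (q + p)
        / (fact q * fact p * fact (m1 - q) * fact (m2 - p)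
           * fact (n1 - p) * fact (n2 - q))"
      by (simp add: t_def herm_of_nat binomial_fact mult_ac flip: of_nat_diff)
  qed
  finally show ?thesis .
qed

end
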